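(* Let $G$ be a connected graph of order $n$. Then for any graph $H$ having a connected component isomorphic to a complete graph and satisfying $n>2c(H)+1\ge 5$, we have $pd(G\odot H)\ge c(H)+2$.
   Context: For a graph $H$ which has a connected component isomorphic to a complete graph, $c(H)$ denotes the maximum cardinality of a connected component of $H$ that is isomorphic to a complete graph. For a connected graph $F$ and an ordered partition $\Pi=\{P_1,\dots,P_t\}$ of $V(F)$, $r(v|\Pi)=(d(v,P_1),\dots,d(v,P_t))$ where $d$ is shortest-path distance and $d(v,P_i)=\min_{u\in P_i}d(v,u)$; $\Pi$ is a resolving partition if $r(u|\Pi)\ne r(v|\Pi)$ for all distinct vertices $u,v$; $pd(F)$ is the minimum number of sets in a resolving partition. For graphs $G$ of order $n_1$ (vertices $v_1,\dots,v_{n_1}$) and $H$, the corona product $G\odot H$ is obtained from one copy of $G$ and $n_1$ copies $H_1,\dots,H_{n_1}$ of $H$ by joining $v_i$ to every vertex of $H_i$. *)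

theory Defs
  imports "Graph_Theory.Graph_Theory" "HOL-Library.Disjoint_Sets"
begin

text \<open>
  A finite simple graph is a \<^locale>\<open>pair_graph\<close>: finite, symmetric, loop-free, without parallel
  arcs; every undirected edge is represented by two opposite arcs. As the arc relation is symmetric,
  the strongly connected components \<^const>\<open>pre_digraph.sccs\<close> are exactly the connected
  components, taken as induced subgraphs.
\<close>

definition complete_components :: "'a pair_pre_digraph \<Rightarrow> ('a, 'a \<times> 'a) pre_digraph set" where
  "complete_components H =
     {C \<in> pre_digraph.sccs (with_proj H). \<exists>k. complete_digraph k C}"

text \<open>Only meaningful if \<^term>\<open>complete_components H\<close> is nonempty.\<close>

definition max_complete_component :: "'a pair_pre_digraph \<Rightarrow> nat" where
  "max_complete_component H = Max ((\<lambda>C. card (verts C)) ` complete_components H)"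

text \<open>
  Shortest-path distance, obtained from the shortest weighted path by giving weight 1 to every arc.
\<close>

definition graph_dist :: "'a pair_pre_digraph \<Rightarrow> 'a \<Rightarrow> 'a \<Rightarrow> ereal" where
  "graph_dist F u v = wf_digraph.\<mu> (with_proj F) (\<lambda>_. 1) u v"

definition set_dist :: "'a pair_pre_digraph \<Rightarrow> 'a \<Rightarrow> 'a set \<Rightarrow> ereal" where
  "set_dist F v P = Min (graph_dist F v ` P)"

definition partition_rep :: "'a pair_pre_digraph \<Rightarrow> 'a set list \<Rightarrow> 'a \<Rightarrow> ereal list" where
  "partition_rep F Ps v = map (set_dist F v) Ps"

text \<open>
  An ordered partition is the list of its classes, which are nonempty and pairwise distinct.
\<close>

definition ordered_partition :: "'a pair_pre_digraph \<Rightarrow> 'a set list \<Rightarrow> bool" where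
  "ordered_partition F Ps \<longleftrightarrow> distinct Ps \<and> partition_on (pverts F) (set Ps)"

definition resolving_partition :: "'a pair_pre_digraph \<Rightarrow> 'a set list \<Rightarrow> bool" where
  "resolving_partition F Ps \<longleftrightarrow> ordered_partition F Ps \<and>
     (\<forall>u \<in> pverts F. \<forall>v \<in> pverts F. u \<noteq> v \<longrightarrow> partition_rep F Ps u \<noteq> partition_rep F Ps v)"

definition partition_dim :: "'a pair_pre_digraph \<Rightarrow> nat" where
  "partition_dim F = (LEAST t. \<exists>Ps. resolving_partition F Ps \<and> length Ps = t)"

text \<open>
  \<^term>\<open>Inl v\<close> is the vertex \<open>v\<close> of the copy of \<open>G\<close>, and \<^term>\<open>Inr (v, x)\<close> is
  the vertex \<open>x\<close> of the copy of \<open>H\<close> attached to \<open>v\<close>.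
\<close>

definition corona ::
  "'a pair_pre_digraph \<Rightarrow> 'b pair_pre_digraph \<Rightarrow> ('a + 'a \<times> 'b) pair_pre_digraph" where
  "corona G H = \<lparr>
     pverts = Inl ` pverts G \<union> Inr ` (pverts G \<times> pverts H),
     parcs = {(Inl u, Inl v) | u v. (u, v) \<in> parcs G}
       \<union> {(Inr (v, x), Inr (v, y)) | v x y. v \<in> pverts G \<and> (x, y) \<in> parcs H}
       \<union> {(Inl v, Inr (v, x)) | v x. v \<in> pverts G \<and> x \<in> pverts H}
       \<union> {(Inr (v, x), Inl v) | v x. v \<in> pverts G \<and> x \<in> pverts H} \<rparr>"

lemma pair_graph_corona:
  assumes "pair_graph G" "pair_graph H"
  shows "pair_graph (corona G H)"
proof -
  interpret G: pair_graph G by fact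
  interpret H: pair_graph H by fact
  have sG: "(v, u) \<in> parcs G" if "(u, v) \<in> parcs G" for u v
    using G.graph_symmetric[of u v] that by simp
  have sH: "(v, u) \<in> parcs H" if "(u, v) \<in> parcs H" for u v
    using H.graph_symmetric[of u v] that by simp
  have wf: "parcs (corona G H) \<subseteq> pverts (corona G H) \<times> pverts (corona G H)"
    by (auto simp: corona_def dest: G.in_arcsD1 G.in_arcsD2 H.in_arcsD1 H.in_arcsD2)
  have fin: "finite (pverts (corona G H))"
    by (simp add: corona_def G.pair_finite_verts H.pair_finite_verts)
  show ?thesis
  proof
    show "fst e \<in> pverts (corona G H)" "snd e \<in> pverts (corona G H)"
      if "e \<in> parcs (corona G H)" for e
      using wf that by auto
    show "finite (pverts (corona G H))" by (fact fin)
    show "finite (parcs (corona G H))"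
      using wf fin by (meson finite_SigmaI finite_subset)
    show "fst e \<noteq> snd e" if "e \<in> parcs (corona G H)" for e
      using that by (auto simp: corona_def dest: G.no_loops' H.no_loops')
    show "symmetric (with_proj (corona G H))"
      by (auto simp: symmetric_def sym_def corona_def intro: sG sH)
  qed
qed

text \<open>
  The partition into singletons is resolving, so the minimum in \<^const>\<open>partition_dim\<close> is attained.
\<close>

lemma graph_dist_eq_0_iff:
  assumes "pair_graph F" "u \<in> pverts F"
  shows "graph_dist F u v = 0 \<longleftrightarrow> u = v"
proof -
  interpret pair_graph F by fact
  have cost: "awalk_cost (\<lambda>_. 1) p = length p" for p
    by (simp add: awalk_cost_def sum_list_triv)
  have eq: "graph_dist F u v = (INF p\<in>{p. awalk u p v}. ereal (length p))"
    by (simp add: graph_dist_def \<mu>_def cost)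
  show ?thesis
  proof
    assume "u = v"
    then have "awalk u [] v" using assms(2) by (simp add: awalk_Nil_iff)
    then have "graph_dist F u v \<le> 0"
      unfolding eq by (auto intro!: INF_lower2[of "[]"] simp: zero_ereal_def)
    moreover have "graph_dist F u v \<ge> 0"
      unfolding eq by (rule INF_greatest) simp
    ultimately show "graph_dist F u v = 0" by simp
  next
    assume 0: "graph_dist F u v = 0"
    show "u = v"
    proof (rule ccontr)
      assume "u \<noteq> v"
      have "1 \<le> graph_dist F u v"
        unfolding eq
      proof (rule INF_greatest)
        fix p assume "p \<in> {p. awalk u p v}"
        with \<open>u \<noteq> v\<close> have "p \<noteq> []" by (auto simp: awalk_Nil_iff)
        then show "1 \<le> ereal (length p)"
          by (cases p) (auto simp: one_ereal_def)
      qed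
      with 0 show False by simp
    qed
  qed
qed

lemma resolving_partition_exists:
  assumes "pair_graph F"
  shows "\<exists>Ps. resolving_partition F Ps"
proof -
  interpret pair_graph F by fact
  obtain xs where xs: "set xs = pverts F" "distinct xs"
    using pair_finite_verts finite_distinct_list by blast
  define Ps where "Ps = map (\<lambda>x. {x}) xs"
  have set: "set Ps = (\<lambda>x. {x}) ` pverts F" by (simp add: Ps_def xs)
  have "ordered_partition F Ps"
    unfolding ordered_partition_def set
    using xs(2) by (simp add: partition_on_singletons Ps_def distinct_map)
  moreover have "partition_rep F Ps u \<noteq> partition_rep F Ps v"
    if uv: "u \<in> pverts F" "v \<in> pverts F" "u \<noteq> v" for u v
  proof
    assume "partition_rep F Ps u = partition_rep F Ps v"
    then have "set_dist F u {u} = set_dist F v {u}"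
      using uv(1) by (auto simp: partition_rep_def set map_eq_conv)
    then show False
      using uv graph_dist_eq_0_iff[OF assms, of u u] graph_dist_eq_0_iff[OF assms, of v u]
      by (simp add: set_dist_def)
  qed
  ultimately show ?thesis by (auto simp: resolving_partition_def)
qed

end

theory Submission
  imports Defs
begin

text \<open>
  Let \<open>K\<close> be a maximum complete component of \<open>H\<close>, of size \<open>c\<close>, let \<open>K\<^sub>i\<close> be its copy attached to
  the vertex \<open>v\<^sub>i\<close> of \<open>G\<close>, and suppose that a resolving partition has at most \<open>c + 1\<close> classes. All
  vertices of \<open>K\<^sub>i\<close> have the same distance to every class avoiding \<open>K\<^sub>i\<close>, and distance 1 to every
  class meeting \<open>K\<^sub>i\<close> other than their own; so they lie in different classes, and \<open>K\<^sub>i\<close> misses at most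
  one class. If no class is missed, vertices of \<open>K\<^sub>i\<close> and \<open>K\<^sub>j\<close> in a common class are not resolved.
  Otherwise let \<open>m\<^sub>i\<close> be the class missed by \<open>K\<^sub>i\<close> and \<open>e\<^sub>i = d(v\<^sub>i, m\<^sub>i)\<close>. Comparing \<open>K\<^sub>i\<close> with \<open>K\<^sub>j\<close>
  shows that \<open>e\<^sub>i = 0\<close> for at most one \<open>i\<close> and that, for \<open>i \<noteq> j\<close>, \<open>m\<^sub>i = m\<^sub>j\<close> implies \<open>e\<^sub>i \<noteq> e\<^sub>j\<close>; comparing \<open>v\<^sub>i\<close> with
  \<open>K\<^sub>j\<close> shows that \<open>m\<^sub>i = m\<^sub>j\<close> also excludes \<open>e\<^sub>i = e\<^sub>j + 1\<close>. Since the distance to \<open>m\<^sub>i\<close> changes by at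
  most 1 along an edge of \<open>G\<close>, this forces \<open>e\<^sub>i \<le> 2\<close>. Hence \<open>i \<mapsto> m\<^sub>i\<close> is injective where
  \<open>e\<^sub>i > 0\<close>, so that \<open>n - 1 \<le> c + 1\<close>, which contradicts \<open>n > 2 c + 1\<close>.
\<close>

section \<open>Distances to vertices and to sets of vertices\<close>

context pair_graph
begin

lemma graph_dist_eq_INF: "graph_dist G u v = (INF p\<in>{p. awalk u p v}. ereal (length p))"
  by (simp add: graph_dist_def \<mu>_def awalk_cost_def sum_list_triv)

lemma graph_dist_le_length: "awalk u p v \<Longrightarrow> graph_dist G u v \<le> ereal (length p)"
  unfolding graph_dist_eq_INF by (rule INF_lower) simp

lemma graph_dist_arc_le:
  assumes "(u, w) \<in> parcs G"
  shows "graph_dist G u v \<le> 1 + graph_dist G w v"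
proof -
  \<comment> \<open>Moving the 1 to the left leaves the bare infimum on the right, as
    \<open>INF_greatest\<close> requires.\<close>
  have "graph_dist G u v - 1 \<le> graph_dist G w v"
    unfolding graph_dist_eq_INF[of w v]
  proof (rule INF_greatest)
    fix p assume "p \<in> {p. awalk w p v}"
    then have "awalk u ((u, w) # p) v" using assms by (simp add: awalk_Cons_iff)
    from graph_dist_le_length[OF this] show "graph_dist G u v - 1 \<le> ereal (length p)"
      by (cases "graph_dist G u v") (auto simp: one_ereal_def)
  qed
  then show ?thesis
    by (cases "graph_dist G u v"; cases "graph_dist G w v") (auto simp: one_ereal_def)
qed

lemma graph_dist_ge_2:
  assumes "u \<noteq> v" "(u, v) \<notin> parcs G"
  shows "2 \<le> graph_dist G u v"
  unfolding graph_dist_eq_INF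
proof (rule INF_greatest)
  fix p assume "p \<in> {p. awalk u p v}"
  then have "2 \<le> length p"
    using assms by (cases p rule: remdups_adj.cases) (auto simp: awalk_Nil_iff awalk_Cons_iff)
  then have "2 \<le> real (length p)" by linarith
  then show "2 \<le> ereal (length p)" by (metis ereal_less_eq(3) numeral_eq_ereal)
qed

lemma set_dist_le:
  "P \<subseteq> pverts G \<Longrightarrow> u \<in> P \<Longrightarrow> set_dist G v P \<le> graph_dist G v u"
  unfolding set_dist_def using pair_finite_verts
  by (auto intro!: Min_le simp: finite_subset)

lemma set_dist_attained:
  assumes "P \<subseteq> pverts G" "P \<noteq> {}"
  obtains u where "u \<in> P" "set_dist G v P = graph_dist G v u"
proof -
  have "set_dist G v P \<in> graph_dist G v ` P"
    unfolding set_dist_def using pair_finite_verts assms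
    by (intro Min_in) (auto simp: finite_subset)
  then show ?thesis using that by auto
qed

text \<open>A shortest walk to a nearest vertex of \<open>P\<close> attains the distance.
  Integrality lets \<open>gap_le_2\<close> pin down distances from inequalities.\<close>

lemma set_dist_nat:
  assumes "P \<subseteq> pverts G" "P \<noteq> {}" "set_dist G v P \<noteq> \<infinity>"
  obtains n :: nat where "set_dist G v P = ereal (real n)"
proof -
  obtain u where u: "set_dist G v P = graph_dist G v u"
    using set_dist_attained assms by metis
  then have "\<exists>p. awalk v p u"
    using assms(3) shortest_path_inf[of v u] unfolding graph_dist_def reachable_awalk by metis
  then obtain p where p: "awalk v p u" "\<And>q. awalk v q u \<Longrightarrow> length p \<le> length q"
    using ex_has_least_nat[of "\<lambda>p. awalk v p u" _ length] by blast
  have "graph_dist G v u = ereal (length p)"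
  proof (rule antisym)
    show "ereal (length p) \<le> graph_dist G v u"
      unfolding graph_dist_eq_INF by (rule INF_greatest) (use p(2) in simp)
  qed (rule graph_dist_le_length[OF p(1)])
  then show ?thesis using that u by simp
qed

lemma set_dist_arc_le:
  assumes "P \<subseteq> pverts G" "P \<noteq> {}" "(u, w) \<in> parcs G"
  shows "set_dist G u P \<le> 1 + set_dist G w P"
proof -
  obtain x where "x \<in> P" "set_dist G w P = graph_dist G w x"
    using set_dist_attained assms by metis
  then show ?thesis
    using set_dist_le[OF assms(1), of x u] graph_dist_arc_le[OF assms(3), of x] by simp
qed

lemma set_dist_in:
  assumes "P \<subseteq> pverts G" "u \<in> P"
  shows "set_dist G u P = 0"
proof -
  have "graph_dist G u x \<ge> 0" for x
    unfolding graph_dist_eq_INF by (rule INF_greatest) simp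
  then have "set_dist G u P \<ge> 0"
    using set_dist_attained[OF assms(1), of u] assms(2) by (metis empty_iff)
  moreover have "set_dist G u P \<le> 0"
    using set_dist_le[OF assms, of u] graph_dist_eq_0_iff[OF pair_graph_axioms, of u u] assms by auto
  ultimately show ?thesis by simp
qed

lemma set_dist_notin_cases:
  assumes "P \<subseteq> pverts G" "P \<noteq> {}" "u \<notin> P"
  shows "set_dist G u P = 1 \<and> (\<exists>w\<in>P. (u, w) \<in> parcs G) \<or>
         2 \<le> set_dist G u P \<and> (\<forall>w\<in>P. (u, w) \<notin> parcs G)"
proof -
  obtain x where x: "x \<in> P" "set_dist G u P = graph_dist G u x"
    using set_dist_attained assms by metis
  have ge: "1 \<le> graph_dist G u x"
    unfolding graph_dist_eq_INF
  proof (rule INF_greatest)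
    fix p assume "p \<in> {p. awalk u p x}"
    then show "1 \<le> ereal (length p)"
      using x assms(3) by (cases p) (auto simp: awalk_Nil_iff one_ereal_def)
  qed
  show ?thesis
  proof (cases "\<exists>w\<in>P. (u, w) \<in> parcs G")
    case True
    then obtain w where w: "w \<in> P" "(u, w) \<in> parcs G" by auto
    have "set_dist G u P \<le> 1"
      using set_dist_arc_le[OF assms(1,2) w(2)] set_dist_in[OF assms(1) w(1)] by simp
    then show ?thesis using True x ge by auto
  next
    case False
    then have "2 \<le> graph_dist G u x" using x assms(3) by (intro graph_dist_ge_2) auto
    then show ?thesis using False x by auto
  qed
qed

text \<open>A walk from \<open>a\<close> to \<open>b\<close> must leave \<open>Q\<close> along some
  arc; this is a discrete intermediate value argument.\<close>

lemma connected_crossing_arc: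
  assumes "connected (with_proj G)" "a \<in> pverts G" "b \<in> pverts G" "Q a" "\<not> Q b"
  obtains u w where "(u, w) \<in> parcs G" "Q u" "\<not> Q w"
proof -
  have "strongly_connected (with_proj G)"
    using assms(1) symmetric_connected_imp_strongly_connected sym_arcs by blast
  then have "a \<rightarrow>\<^sup>*\<^bsub>with_proj G\<^esub> b" using assms(2,3) by (auto simp: strongly_connected_def)
  then have "(\<exists>u w. (u, w) \<in> parcs G \<and> Q u \<and> \<not> Q w)"
    using assms(4,5)
  proof (induct rule: converse_reachable_induct)
    case base
    then show ?case by simp
  next
    case (step x y)
    then show ?case by (cases "Q y") auto
  qed
  then show ?thesis using that by blast
qed

section \<open>Complete components as closed cliques\<close>

lemma complete_component_props:
  assumes "C \<in> complete_components G"
  shows "verts C \<subseteq> pverts G" "verts C \<noteq> {}"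
    "\<And>x y. x \<in> verts C \<Longrightarrow> y \<in> verts C \<Longrightarrow> x \<noteq> y \<Longrightarrow> (x, y) \<in> parcs G"
    "\<And>x y. x \<in> verts C \<Longrightarrow> (x, y) \<in> parcs G \<Longrightarrow> y \<in> verts C"
proof -
  from assms obtain k where C: "C \<in> sccs" "complete_digraph k C"
    by (auto simp: complete_components_def)
  then have ind: "induced_subgraph C (with_proj G)" and sc: "strongly_connected C"
    by (auto simp: sccs_def)
  then have sub: "subgraph C (with_proj G)" by (simp add: induced_subgraph_def)
  show "verts C \<subseteq> pverts G" using sub by (auto simp: subgraph_def)
  show "verts C \<noteq> {}" using sc by (auto simp: strongly_connected_def)
  show "(x, y) \<in> parcs G" if "x \<in> verts C" "y \<in> verts C" "x \<noteq> y" for x y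
  proof -
    have "(x, y) \<in> arcs_ends C" using C(2) that by (auto simp: complete_digraph_def)
    then show ?thesis using arcs_ends_mono[OF sub] by auto
  qed
  have S: "verts C \<in> sccs_verts" using C(1) in_sccs_vertsI_sccs by blast
  show "y \<in> verts C" if "x \<in> verts C" and xy: "(x, y) \<in> parcs G" for x y
  proof -
    \<comment> \<open>Arcs are symmetric, so \<open>y\<close> also reaches \<open>x\<close> and both
      lie in one strongly connected component.\<close>
    have "x \<rightarrow>\<^sup>*\<^bsub>with_proj G\<^esub> y" 
      by (rule reachable_adjI) (simp add: xy)
    moreover from this have "y \<rightarrow>\<^sup>*\<^bsub>with_proj G\<^esub> x"
      by (rule symmetric_reachable[OF sym_arcs])
    ultimately show ?thesis
      using S that(1) unfolding in_sccs_verts_conv_reachable by metis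
  qed
qed

lemma max_complete_component_attained:
  assumes "complete_components G \<noteq> {}"
  obtains C where "C \<in> complete_components G" "card (verts C) = max_complete_component G"
proof -
  have "(\<lambda>C. card (verts C)) ` complete_components G \<subseteq> {..card (pverts G)}"
    using complete_component_props(1) by (auto intro!: card_mono pair_finite_verts)
  then have "finite ((\<lambda>C. card (verts C)) ` complete_components G)"
    using finite_subset by blast
  from Max_in[OF this] assms
  have "max_complete_component G \<in> (\<lambda>C. card (verts C)) ` complete_components G"
    by (simp add: max_complete_component_def)
  then show ?thesis using that by auto
qed

end

section \<open>Copies of a closed clique in the corona\<close>

locale corona_resolving = G: pair_graph G + H: pair_graph H
  for G :: "'a pair_pre_digraph" and H :: "'b pair_pre_digraph" +
  fixes K :: "'b set" and \<P> :: "('a + 'a \<times> 'b) set set"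
  assumes connected: "connected (with_proj G)"
    and K_verts: "K \<subseteq> pverts H"
    and K_complete: "\<And>x y. x \<in> K \<Longrightarrow> y \<in> K \<Longrightarrow> x \<noteq> y \<Longrightarrow> (x, y) \<in> parcs H"
    and K_closed: "\<And>x y. x \<in> K \<Longrightarrow> (x, y) \<in> parcs H \<Longrightarrow> y \<in> K"
    and partition: "partition_on (pverts (corona G H)) \<P>"
    and resolving: "\<And>u v. u \<in> pverts (corona G H) \<Longrightarrow> v \<in> pverts (corona G H) \<Longrightarrow>
      \<forall>P\<in>\<P>. set_dist (corona G H) u P = set_dist (corona G H) v P \<Longrightarrow> u = v"
begin

abbreviation F where "F \<equiv> corona G H"

sublocale F: pair_graph F
  using pair_graph_corona G.pair_graph_axioms H.pair_graph_axioms .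

abbreviation copy :: "'a \<Rightarrow> ('a + 'a \<times> 'b) set" where
  "copy k \<equiv> (\<lambda>x. Inr (k, x)) ` K"

text \<open>A set, so that the cases of no missed class and of one missed class share the distance
  lemmas.\<close>

definition missed :: "'a \<Rightarrow> ('a + 'a \<times> 'b) set set" where
  "missed k = {P \<in> \<P>. P \<inter> copy k = {}}"

lemma class_verts: "P \<in> \<P> \<Longrightarrow> P \<subseteq> pverts F"
  using partition by (auto simp: partition_on_def)

lemma class_nonempty: "P \<in> \<P> \<Longrightarrow> P \<noteq> {}"
  using partition by (auto simp: partition_on_def)

lemma class_eq: "P \<in> \<P> \<Longrightarrow> Q \<in> \<P> \<Longrightarrow> x \<in> P \<Longrightarrow> x \<in> Q \<Longrightarrow> P = Q"
  using partition by (auto simp: partition_on_def disjoint_def)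

lemma class_exists:
  assumes "x \<in> pverts F" obtains P where "P \<in> \<P>" "x \<in> P"
  using partition assms by (auto simp: partition_on_def)

lemma finite_classes: "finite \<P>"
  using partition F.pair_finite_verts finite_elements by blast

lemma verts_Inl: "k \<in> pverts G \<Longrightarrow> Inl k \<in> pverts F"
  by (auto simp: corona_def)

lemma verts_Inr: "k \<in> pverts G \<Longrightarrow> x \<in> K \<Longrightarrow> Inr (k, x) \<in> pverts F"
  using K_verts by (auto simp: corona_def)

text \<open>Both distances to the common class are 0, so only the other classes could resolve the
  two vertices.\<close>

lemma same_class_eq:
  assumes "A \<in> \<P>" "u \<in> A" "v \<in> A"
    and "\<And>P. P \<in> \<P> \<Longrightarrow> P \<noteq> A \<Longrightarrow> set_dist F u P = set_dist F v P"
  shows "u = v"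
proof (rule resolving)
  show "u \<in> pverts F" "v \<in> pverts F" using class_verts assms by auto
  show "\<forall>P\<in>\<P>. set_dist F u P = set_dist F v P"
    using assms F.set_dist_in[OF class_verts[OF assms(1)]] by metis
qed

text \<open>\<open>K\<close> is closed under the arcs of \<open>H\<close>, so a walk can leave the
  copy only through its hub \<open>Inl k\<close>; cutting it there drops at least one arc.\<close>

lemma walk_leaves_copy:
  assumes "x \<in> K" "F.awalk (Inr (k, x)) p u" "u \<notin> copy k"
  shows "\<exists>q. F.awalk (Inl k) q u \<and> Suc (length q) \<le> length p"
  using assms
proof (induct p arbitrary: x)
  case Nil
  then show ?case by (auto simp: F.awalk_Nil_iff)
next
  case (Cons e p)
  obtain w where e: "e = (Inr (k, x), w)" "(Inr (k, x), w) \<in> parcs F" "F.awalk w p u"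
    using Cons.prems(2) by (cases e) (auto simp: F.awalk_Cons_iff)
  then consider "w = Inl k" | y where "w = Inr (k, y)" "(x, y) \<in> parcs H"
    by (auto simp: corona_def)
  then show ?case
  proof cases
    case 1
    then show ?thesis using e by auto
  next
    case 2
    have "F.awalk (Inr (k, y)) p u" using e(3) 2(1) by simp
    from Cons.hyps[OF K_closed[OF Cons.prems(1) 2(2)] this Cons.prems(3)]
    show ?thesis by auto
  qed
qed

lemma arc_copy_hub: "k \<in> pverts G \<Longrightarrow> x \<in> K \<Longrightarrow> (Inr (k, x), Inl k) \<in> parcs F"
  and arc_hub_copy: "k \<in> pverts G \<Longrightarrow> x \<in> K \<Longrightarrow> (Inl k, Inr (k, x)) \<in> parcs F"
  and arc_copy: "k \<in> pverts G \<Longrightarrow> x \<in> K \<Longrightarrow> y \<in> K \<Longrightarrow> x \<noteq> y \<Longrightarrow>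
    (Inr (k, x), Inr (k, y)) \<in> parcs F"
  using K_verts K_complete by (auto simp: corona_def)

lemma graph_dist_copy:
  assumes "k \<in> pverts G" "x \<in> K" "u \<notin> copy k"
  shows "graph_dist F (Inr (k, x)) u = 1 + graph_dist F (Inl k) u"
proof (rule antisym)
  show "graph_dist F (Inr (k, x)) u \<le> 1 + graph_dist F (Inl k) u"
    using F.graph_dist_arc_le arc_copy_hub assms by blast
  show "1 + graph_dist F (Inl k) u \<le> graph_dist F (Inr (k, x)) u"
    unfolding F.graph_dist_eq_INF[of "Inr (k, x)"]
  proof (rule INF_greatest)
    fix p assume "p \<in> {p. F.awalk (Inr (k, x)) p u}"
    then obtain q where q: "F.awalk (Inl k) q u" "Suc (length q) \<le> length p"
      using walk_leaves_copy assms by blast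
    have "1 + graph_dist F (Inl k) u \<le> 1 + ereal (length q)"
      using F.graph_dist_le_length[OF q(1)] add_left_mono by blast
    also have "\<dots> \<le> ereal (length p)" using q(2) by (simp add: one_ereal_def)
    finally show "1 + graph_dist F (Inl k) u \<le> ereal (length p)" .
  qed
qed

text \<open>All of \<open>P\<close> lies outside the copy, so each of its vertices is reached
  through the hub; the distance is the same for every \<open>x\<close>.\<close>

lemma set_dist_missed:
  assumes "k \<in> pverts G" "x \<in> K" "P \<in> missed k"
  shows "set_dist F (Inr (k, x)) P = 1 + set_dist F (Inl k) P"
proof (rule antisym)
  have P: "P \<in> \<P>" "P \<inter> copy k = {}" using assms by (auto simp: missed_def)
  note PF = class_verts[OF P(1)] class_nonempty[OF P(1)]
  show "set_dist F (Inr (k, x)) P \<le> 1 + set_dist F (Inl k) P"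
    using F.set_dist_arc_le[OF PF] arc_copy_hub assms by blast
  obtain u where u: "u \<in> P" "set_dist F (Inr (k, x)) P = graph_dist F (Inr (k, x)) u"
    using F.set_dist_attained[OF PF] by metis
  then have "set_dist F (Inr (k, x)) P = 1 + graph_dist F (Inl k) u"
    using graph_dist_copy[of k x u] P assms by auto
  then show "1 + set_dist F (Inl k) P \<le> set_dist F (Inr (k, x)) P"
    using F.set_dist_le[OF PF(1) u(1)] add_left_mono by metis
qed

lemma set_dist_met:
  assumes "k \<in> pverts G" "x \<in> K" "P \<in> \<P> - missed k" "Inr (k, x) \<notin> P"
  shows "set_dist F (Inr (k, x)) P = 1"
proof -
  obtain y where y: "y \<in> K" "Inr (k, y) \<in> P" using assms(3) by (auto simp: missed_def)
  then have "(Inr (k, x), Inr (k, y)) \<in> parcs F" using arc_copy assms by metis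
  then show ?thesis
    using F.set_dist_notin_cases[OF class_verts class_nonempty assms(4)] assms(3) y by blast
qed

lemma set_dist_hub_met:
  assumes "k \<in> pverts G" "P \<in> \<P> - missed k" "Inl k \<notin> P"
  shows "set_dist F (Inl k) P = 1"
proof -
  obtain y where y: "y \<in> K" "Inr (k, y) \<in> P" using assms(2) by (auto simp: missed_def)
  then have "(Inl k, Inr (k, y)) \<in> parcs F" using arc_hub_copy assms by metis
  then show ?thesis
    using F.set_dist_notin_cases[OF class_verts class_nonempty assms(3)] assms(2) y by blast
qed

lemma copy_vertices_separated:
  assumes "k \<in> pverts G" "x \<in> K" "y \<in> K" "A \<in> \<P>" "Inr (k, x) \<in> A" "Inr (k, y) \<in> A"
  shows "x = y"
proof -
  have "set_dist F (Inr (k, x)) P = set_dist F (Inr (k, y)) P" if P: "P \<in> \<P>" "P \<noteq> A" for P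
  proof (cases "P \<in> missed k")
    case True
    then show ?thesis using set_dist_missed assms by simp
  next
    case False
    moreover have "Inr (k, x) \<notin> P" "Inr (k, y) \<notin> P" using class_eq P assms by metis+
    ultimately show ?thesis using set_dist_met assms P by simp
  qed
  from same_class_eq[OF assms(4-6) this] show ?thesis by simp
qed

text \<open>Sending each vertex of the copy to its class is injective by
  \<open>copy_vertices_separated\<close>, and the image consists of the classes met.\<close>

lemma card_missed:
  assumes "k \<in> pverts G"
  shows "card (missed k) + card K = card \<P>"
proof -
  define f where "f x = (SOME P. P \<in> \<P> \<and> Inr (k, x) \<in> P)" for x
  have f: "f x \<in> \<P>" "Inr (k, x) \<in> f x" if "x \<in> K" for x
    using someI_ex[of "\<lambda>P. P \<in> \<P> \<and> Inr (k, x) \<in> P"] class_exists[OF verts_Inr[OF assms that]]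
    unfolding f_def by blast+
  have "bij_betw f K (\<P> - missed k)"
    unfolding bij_betw_def
  proof
    show "inj_on f K"
      using copy_vertices_separated[OF assms] f by (metis inj_onI)
    show "f ` K = \<P> - missed k"
    proof (intro set_eqI iffI)
      fix P assume "P \<in> f ` K"
      then show "P \<in> \<P> - missed k" using f by (auto simp: missed_def)
    next
      fix P assume P: "P \<in> \<P> - missed k"
      then obtain x where "x \<in> K" "Inr (k, x) \<in> P" by (auto simp: missed_def)
      then show "P \<in> f ` K" using f class_eq P by blast
    qed
  qed
  then have "card K = card (\<P> - missed k)" by (rule bij_betw_same_card)
  moreover have "missed k \<subseteq> \<P>" by (auto simp: missed_def)
  then have "card (\<P> - missed k) = card \<P> - card (missed k)" "card (missed k) \<le> card \<P>"
    using finite_classes by (auto intro: card_Diff_subset card_mono finite_subset)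
  ultimately show ?thesis by simp
qed

text \<open>Compare the vertices of the two copies in \<open>A\<close>: every other class met by
  both copies is at distance 1 from each, so only the missed classes, treated in \<open>eq\<close>,
  could resolve them.\<close>

lemma met_copies_eq:
  assumes ij: "i \<in> pverts G" "j \<in> pverts G" and A: "A \<in> \<P> - missed i - missed j"
    and eq: "\<And>P x y. P \<in> \<P> \<Longrightarrow> P \<in> missed i \<union> missed j \<Longrightarrow> x \<in> K \<Longrightarrow> y \<in> K \<Longrightarrow>
      Inr (i, x) \<notin> P \<Longrightarrow> Inr (j, y) \<notin> P \<Longrightarrow>
      set_dist F (Inr (i, x)) P = set_dist F (Inr (j, y)) P"
  shows "i = j"
proof -
  obtain x y where xy: "x \<in> K" "y \<in> K" "Inr (i, x) \<in> A" "Inr (j, y) \<in> A"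
    using A by (auto simp: missed_def)
  have "set_dist F (Inr (i, x)) P = set_dist F (Inr (j, y)) P" if P: "P \<in> \<P>" "P \<noteq> A" for P
  proof -
    have nin: "Inr (i, x) \<notin> P" "Inr (j, y) \<notin> P" using class_eq[of P A] P A xy by blast+
    show ?thesis
    proof (cases "P \<in> missed i \<union> missed j")
      case True
      then show ?thesis using eq P xy nin by blast
    next
      case False
      then show ?thesis using set_dist_met ij P xy nin by simp
    qed
  qed
  moreover have "A \<in> \<P>" using A by simp
  ultimately have "Inr (i, x) = (Inr (j, y) :: 'a + 'a \<times> 'b)"
    using same_class_eq xy(3,4) by presburger
  then show ?thesis by simp
qed

end

section \<open>One class more than the clique has vertices\<close>

locale corona_resolving_Suc = corona_resolving +
  assumes card_K: "card K \<ge> 2" and card_classes: "card \<P> = Suc (card K)"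
begin

definition miss :: "'a \<Rightarrow> ('a + 'a \<times> 'b) set" where
  "miss k = the_elem (missed k)"

text \<open>One less than the common distance from the vertices of the copy to the missed
  class.\<close>

definition gap :: "'a \<Rightarrow> ereal" where
  "gap k = set_dist F (Inl k) (miss k)"

lemma missed_eq: "k \<in> pverts G \<Longrightarrow> missed k = {miss k}"
  using card_missed[of k] card_classes unfolding miss_def
  by (metis One_nat_def add_right_cancel card_1_singletonE plus_1_eq_Suc the_elem_eq)

lemma miss_class: "k \<in> pverts G \<Longrightarrow> miss k \<in> \<P>"
  using missed_eq[of k] by (auto simp: missed_def)

text \<open>Two copies miss at most two classes in total, while \<open>card K \<ge> 2\<close> makes
  at least three classes.\<close>

lemma met_class_exists:
  assumes "i \<in> pverts G" "j \<in> pverts G"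
  shows "\<exists>A. A \<in> \<P> - missed i - missed j"
proof (rule ccontr)
  assume "\<not> ?thesis"
  then have "\<P> \<subseteq> {miss i, miss j}" using missed_eq[OF assms(1)] missed_eq[OF assms(2)] by auto
  then have "card \<P> \<le> card {miss i, miss j}" by (intro card_mono) auto
  also have "\<dots> \<le> 2" by (simp add: card_insert_if)
  finally show False using card_K card_classes by linarith
qed

text \<open>With gap 0 even the missed class is at distance 1 from the copy, so each vertex of the
  copy is at distance 1 from every class but its own.\<close>

lemma gap_0_unique:
  assumes ij: "i \<in> pverts G" "j \<in> pverts G" and 0: "gap i = 0" "gap j = 0"
  shows "i = j"
proof -
  obtain A where A: "A \<in> \<P> - missed i - missed j" using met_class_exists ij by blast
  have one: "set_dist F (Inr (k, x)) P = 1"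
    if "k \<in> pverts G" "gap k = 0" "x \<in> K" "P \<in> \<P>" "Inr (k, x) \<notin> P" for k x P
  proof (cases "P \<in> missed k")
    case True
    then have "P = miss k" using missed_eq that(1) by simp
    then show ?thesis using set_dist_missed[OF that(1,3) True] that(2) by (simp add: gap_def)
  qed (use that set_dist_met in simp)
  show ?thesis
  proof (rule met_copies_eq[OF ij A])
    fix P x y assume "P \<in> \<P>" "x \<in> K" "y \<in> K" "Inr (i, x) \<notin> P" "Inr (j, y) \<notin> P"
    then show "set_dist F (Inr (i, x)) P = set_dist F (Inr (j, y)) P"
      using one[OF ij(1) 0(1)] one[OF ij(2) 0(2)] by metis
  qed
qed

lemma gap_unique:
  assumes ij: "i \<in> pverts G" "j \<in> pverts G" and eq: "miss i = miss j" "gap i = gap j"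
  shows "i = j"
proof -
  obtain A where A: "A \<in> \<P> - missed i - missed j" using met_class_exists ij by blast
  show ?thesis
  proof (rule met_copies_eq[OF ij A])
    fix P x y assume P: "P \<in> missed i \<union> missed j" and xy: "x \<in> K" "y \<in> K"
    then have "P = miss i" "P \<in> missed i" "P \<in> missed j"
      using missed_eq[OF ij(1)] missed_eq[OF ij(2)] eq(1) by auto
    then show "set_dist F (Inr (i, x)) P = set_dist F (Inr (j, y)) P"
      using set_dist_missed[OF ij(1) xy(1)] set_dist_missed[OF ij(2) xy(2)] eq by (simp add: gap_def)
  qed
qed

text \<open>The hub of \<open>i\<close> is compared with the vertex of copy \<open>j\<close> in the
  same class: otherwise both would be at distance \<open>gap i\<close> from the common missed class
  and at distance 1 from every remaining class.\<close>

lemma gap_not_consecutive: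
  assumes ij: "i \<in> pverts G" "j \<in> pverts G" and eq: "miss i = miss j" and pos: "gap i \<noteq> 0"
  shows "gap i \<noteq> 1 + gap j"
proof
  assume gap: "gap i = 1 + gap j"
  obtain A where A: "A \<in> \<P>" "Inl i \<in> A" using class_exists verts_Inl ij by blast
  \<comment> \<open>A nonzero gap keeps the hub out of the missed class, so copy \<open>j\<close>
    meets the class of the hub.\<close>
  have "A \<noteq> miss i"
    using pos F.set_dist_in[OF class_verts[OF A(1)] A(2)] by (auto simp: gap_def)
  then have "A \<notin> missed j" using missed_eq ij eq by auto
  then obtain y where y: "y \<in> K" "Inr (j, y) \<in> A" using A by (auto simp: missed_def)
  have "set_dist F (Inl i) P = set_dist F (Inr (j, y)) P" if P: "P \<in> \<P>" "P \<noteq> A" for P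
  proof (cases "P = miss i")
    case True
    then show ?thesis
      using gap eq set_dist_missed[of j y P] ij y missed_eq by (auto simp: gap_def)
  next
    case False
    moreover have "Inl i \<notin> P" "Inr (j, y) \<notin> P" using class_eq[of P A] P A y by blast+
    ultimately show ?thesis
      using set_dist_hub_met[of i P] set_dist_met[of j y P] ij y missed_eq P eq by auto
  qed
  from same_class_eq[OF A(1,2) y(2) this] show False by simp
qed

text \<open>The hub is adjacent to a vertex of every class met by its copy, so only the missed class
  can be at distance 2 or more.\<close>

lemma miss_if_far:
  assumes k: "k \<in> pverts G" and P: "P \<in> \<P>" and far: "2 \<le> set_dist F (Inl k) P"
  shows "miss k = P"
proof (rule ccontr)
  assume "miss k \<noteq> P"
  then have "P \<in> \<P> - missed k" using missed_eq k P by auto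
  then have "set_dist F (Inl k) P \<le> 1"
    using set_dist_hub_met[OF k] F.set_dist_in[OF class_verts[OF P]] by (cases "Inl k \<in> P") auto
  with far have "(2::ereal) \<le> 1" by (rule order_trans)
  then show False by simp
qed

text \<open>If the hub of \<open>i\<close> were farther than 2 from \<open>P = miss i\<close>, some
  arc of \<open>G\<close> would join hubs at distances 3 and 2 from \<open>P\<close>; both copies
  then miss \<open>P\<close>, against \<open>gap_not_consecutive\<close>.\<close>

lemma gap_le_2:
  assumes i: "i \<in> pverts G"
  shows "gap i \<le> 2"
proof (rule ccontr)
  assume far: "\<not> gap i \<le> 2"
  define P where "P = miss i"
  define D where "D k = set_dist F (Inl k) P" for k
  have P: "P \<in> \<P>" using miss_class i by (simp add: P_def)
  note PF = class_verts[OF P] class_nonempty[OF P]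
  obtain z where z: "z \<in> P" using PF by blast
  \<comment> \<open>Each vertex of \<open>P\<close> is a hub or adjacent to one.\<close>
  have "\<exists>k\<in>pverts G. D k \<le> 1"
  proof (cases z)
    case (Inl k)
    then show ?thesis using F.set_dist_in[OF PF(1)] z PF by (force simp: D_def corona_def)
  next
    case (Inr kx)
    obtain k x where kx: "kx = (k, x)" by fastforce
    have k: "k \<in> pverts G" "(Inl k, z) \<in> parcs F" using z Inr PF kx by (auto simp: corona_def)
    then show ?thesis
      using F.set_dist_arc_le[OF PF k(2)] F.set_dist_in[OF PF(1) z] by (auto simp: D_def)
  qed
  then obtain k where k: "k \<in> pverts G" "D k \<le> 1" by blast
  have "\<not> \<not> D k \<le> 2" using order_trans[OF k(2), of 2] by simp
  then obtain u w where uw: "(u, w) \<in> parcs G" "\<not> D u \<le> 2" "D w \<le> 2"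
    using G.connected_crossing_arc[OF connected i k(1), of "\<lambda>k. \<not> D k \<le> 2"] far
    by (auto simp: D_def P_def gap_def)
  have V: "u \<in> pverts G" "w \<in> pverts G" using uw(1) G.in_arcsD1 G.in_arcsD2 by auto
  have arc: "(Inl u, Inl w) \<in> parcs F" using uw(1) by (auto simp: corona_def)
  have lip: "D u \<le> 1 + D w" using F.set_dist_arc_le[OF PF arc] by (simp add: D_def)
  have Mu: "miss u = P" using miss_if_far[OF V(1) P] uw(2) by (auto simp: D_def)
  have "Inl w \<notin> P"
    using F.set_dist_in[OF PF(1)] lip uw(2) order_trans[of "D u" 1 2] by (auto simp: D_def)
  then have "D w \<noteq> 0"
    using F.set_dist_notin_cases[OF PF, of "Inl w"] by (auto simp: D_def)
  moreover have "D w \<noteq> \<infinity>" using uw(3) by auto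
  then obtain b :: nat where b: "D w = ereal (real b)"
    using F.set_dist_nat[OF PF] by (metis D_def)
  moreover have "D u \<noteq> \<infinity>" using lip b by (auto simp: one_ereal_def)
  then obtain a :: nat where a: "D u = ereal (real a)"
    using F.set_dist_nat[OF PF] by (metis D_def)
  \<comment> \<open>For naturals, \<open>a > 2\<close>, \<open>b \<le> 2\<close> and
    \<open>a \<le> 1 + b\<close> leave only these values.\<close>
  ultimately have "b = 2" "a = 3"
    using uw(2,3) lip by (simp_all add: one_ereal_def numeral_eq_ereal zero_ereal_def)
  then have D: "D w = 2" "D u = 1 + D w"
    using a b by (simp_all add: one_ereal_def numeral_eq_ereal)
  then have Mw: "miss w = P" using miss_if_far[OF V(2) P] by (simp add: D_def)
  show False
    using gap_not_consecutive[OF V] Mu Mw D uw(2) by (auto simp: gap_def D_def)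
qed

text \<open>At most one vertex has gap 0. All others have gap 1 or 2, where a shared missed class
  would force equal or consecutive gaps; so \<open>miss\<close> is injective on them and there are
  at most \<open>card K + 1\<close>.\<close>

lemma card_verts_le: "card (pverts G) \<le> card K + 2"
proof -
  let ?Z = "{i \<in> pverts G. gap i = 0}" and ?N = "{i \<in> pverts G. gap i \<noteq> 0}"
  have "card ?Z \<le> 1"
    using gap_0_unique G.pair_finite_verts by (simp add: card_le_Suc0_iff_eq)
  have gap: "gap i = 1 \<or> gap i = 2" if "i \<in> ?N" for i
  proof -
    have i: "i \<in> pverts G" "gap i \<noteq> 0" using that by auto
    note PF = class_verts[OF miss_class[OF i(1)]] class_nonempty[OF miss_class[OF i(1)]]
    have "Inl i \<notin> miss i" using F.set_dist_in[OF PF(1)] i(2) by (auto simp: gap_def)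
    then show ?thesis
      using F.set_dist_notin_cases[OF PF, of "Inl i"] gap_le_2[OF i(1)] by (auto simp: gap_def)
  qed
  have "inj_on miss ?N"
  proof (rule inj_onI)
    fix i j assume ij: "i \<in> ?N" "j \<in> ?N" and eq: "miss i = miss j"
    have V: "i \<in> pverts G" "j \<in> pverts G" using ij by auto
    have "gap i \<noteq> 1 + gap j" "gap j \<noteq> 1 + gap i"
      using gap_not_consecutive V eq ij by auto
    then have "gap i = gap j" using gap[OF ij(1)] gap[OF ij(2)] by (auto simp: one_add_one)
    then show "i = j" using gap_unique V eq by blast
  qed
  then have "card ?N \<le> card \<P>"
    using miss_class finite_classes by (intro card_inj_on_le) auto
  moreover have "card (pverts G) = card ?Z + card ?N"
    using G.pair_finite_verts by (subst card_Un_disjoint[symmetric]) (auto intro!: arg_cong[of _ _ card])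
  ultimately show ?thesis using \<open>card ?Z \<le> 1\<close> card_classes by simp
qed

end

section \<open>The lower bound, from the cases of \<open>c\<close> and \<open>c + 1\<close>
  classes\<close>

theorem theorem11:
  fixes G :: "'a pair_pre_digraph" and H :: "'b pair_pre_digraph" and n :: nat
  assumes "pair_graph G" and "connected (with_proj G)" and "card (pverts G) = n"
    and "pair_graph H" and "complete_components H \<noteq> {}"
    and "n > 2 * max_complete_component H + 1" and "2 * max_complete_component H + 1 \<ge> 5"
  shows "partition_dim (corona G H) \<ge> max_complete_component H + 2"
proof (rule ccontr)
  let ?F = "corona G H" and ?c = "max_complete_component H"
  assume small: "\<not> ?thesis"
  have "\<exists>t Ps. resolving_partition ?F Ps \<and> length Ps = t"
    using resolving_partition_exists[OF pair_graph_corona[OF assms(1,4)]] by blast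
  then have "\<exists>Ps. resolving_partition ?F Ps \<and> length Ps = partition_dim ?F"
    unfolding partition_dim_def by (rule LeastI_ex)
  then obtain Ps where Ps: "resolving_partition ?F Ps" "length Ps < ?c + 2"
    using small by auto
  obtain C where C: "C \<in> complete_components H" "card (verts C) = ?c"
    using pair_graph.max_complete_component_attained[OF assms(4,5)] by blast
  note C_props = pair_graph.complete_component_props[OF assms(4) C(1)]
  interpret G: pair_graph G by fact
  interpret H: pair_graph H by fact
  interpret corona_resolving G H "verts C" "set Ps"
  proof
    show "connected (with_proj G)" by fact
    show "verts C \<subseteq> pverts H" by (fact C_props(1))
    show "(x, y) \<in> parcs H" if "x \<in> verts C" "y \<in> verts C" "x \<noteq> y" for x y
      using C_props(3) that .
    show "y \<in> verts C" if "x \<in> verts C" "(x, y) \<in> parcs H" for x y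
      using C_props(4) that .
    show "partition_on (pverts ?F) (set Ps)"
      using Ps(1) by (simp add: resolving_partition_def ordered_partition_def)
    show "u = v" if "u \<in> pverts ?F" "v \<in> pverts ?F"
      "\<forall>P\<in>set Ps. set_dist ?F u P = set_dist ?F v P" for u v
      using Ps(1) that by (force simp: resolving_partition_def partition_rep_def)
  qed
  have "card (set Ps) < ?c + 2"
    using Ps distinct_card[of Ps] by (simp add: resolving_partition_def ordered_partition_def)
  moreover have card: "card (missed k) + ?c = card (set Ps)" if "k \<in> pverts G" for k
    using card_missed[OF that] C(2) by simp
  \<comment> \<open>The bound on \<open>n\<close> yields two distinct vertices of \<open>G\<close>,
    hence two copies to compare.\<close>
  moreover have "\<not> card (pverts G) \<le> Suc 0" using assms(3,6) by simp
  then obtain i j where ij: "i \<in> pverts G" "j \<in> pverts G" "i \<noteq> j"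
    using card_le_Suc0_iff_eq[OF G.pair_finite_verts] by auto
  ultimately consider "card (set Ps) = ?c" | "card (set Ps) = Suc ?c"
    by fastforce
  then show False
  proof cases
    case 1
    have fin: "finite (missed k)" for k
      using finite_classes by (rule finite_subset[rotated]) (auto simp: missed_def)
    have none: "missed k = {}" if "k \<in> pverts G" for k
      using card[OF that] 1 fin by auto
    \<comment> \<open>With nothing missed, any class is met by both copies and the condition on
      missed classes is vacuous.\<close>
    obtain A where "A \<in> set Ps" using class_exists verts_Inl ij(1) by blast
    then show False
      using met_copies_eq[of i j A] ij none by auto
  next
    case 2
    interpret corona_resolving_Suc G H "verts C" "set Ps"
      by standard (use 2 C(2) assms(7) in simp_all)
    \<comment> \<open>The count gives \<open>n \<le> c + 2\<close>, which is less than
      \<open>2 * c + 1\<close> because \<open>c \<ge> 2\<close>.\<close>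
    show False using card_verts_le C(2) assms(3,6,7) by simp
  qed
qed

end
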